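(* Let $c>0$. Let $G$ be an $n$-vertex disk graph with $\alpha(G)=cn$, where $n$ is sufficiently large. Then $h(G)\le \frac{25n}{\log n}$.
   Context: All graphs are finite and simple; $\log$ is base $2$. A disk graph is the intersection graph of a finite family of disks in the plane (vertices are disks, adjacent iff the disks intersect). $\alpha(G)$ is the independence number. A hitting set of $G$ is a set $T\subseteq V(G)$ meeting every maximum independent set of $G$; $h(G)$ is the minimum size of a hitting set. *)

theory Defs
  imports "HOL-Analysis.Analysis" "Graph_Theory.Pair_Digraph"
begin

text \<open>
  A finite simple graph is a \<^locale>\<open>pair_graph\<close>: a finite vertex set together with an
  irreflexive symmetric set of arcs, each edge being present in both directions.
\<close>

definition intersection_graph :: "'i set \<Rightarrow> ('i \<Rightarrow> 'p set) \<Rightarrow> 'i pair_pre_digraph" where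
  "intersection_graph I F =
     \<lparr> pverts = I, parcs = {(i, j). i \<in> I \<and> j \<in> I \<and> i \<noteq> j \<and> F i \<inter> F j \<noteq> {}} \<rparr>"

definition is_disk :: "(real ^ 2) set \<Rightarrow> bool" where
  "is_disk D \<longleftrightarrow> (\<exists>x r. 0 < r \<and> D = cball x r)"

text \<open>
  The disks are indexed by the vertices of the graph. This makes the notion invariant under
  isomorphism and lets a disk occur several times in the family, as distinct vertices.
\<close>

definition disk_graph :: "'a pair_pre_digraph \<Rightarrow> bool" where
  "disk_graph G \<longleftrightarrow> finite (pverts G) \<and>
     (\<exists>D. (\<forall>v \<in> pverts G. is_disk (D v)) \<and> G = intersection_graph (pverts G) D)"

lemma pair_graph_intersection_graph:
  assumes "finite I"
  shows "pair_graph (intersection_graph I F)"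
proof -
  have "finite {(i, j). i \<in> I \<and> j \<in> I \<and> i \<noteq> j \<and> F i \<inter> F j \<noteq> {}}"
    by (rule finite_subset[of _ "I \<times> I"]) (use assms in auto)
  then show ?thesis
    using assms
    by unfold_locales (auto simp: intersection_graph_def symmetric_def sym_def)
qed

lemma disk_graph_imp_pair_graph: "disk_graph G \<Longrightarrow> pair_graph G"
  unfolding disk_graph_def by (metis pair_graph_intersection_graph)

definition independent_set :: "'a pair_pre_digraph \<Rightarrow> 'a set \<Rightarrow> bool" where
  "independent_set G S \<longleftrightarrow> S \<subseteq> pverts G \<and> (\<forall>u \<in> S. \<forall>v \<in> S. (u, v) \<notin> parcs G)"

definition independence_number :: "'a pair_pre_digraph \<Rightarrow> nat" where
  "independence_number G = Max (card ` {S. independent_set G S})"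

definition maximum_independent_set :: "'a pair_pre_digraph \<Rightarrow> 'a set \<Rightarrow> bool" where
  "maximum_independent_set G S \<longleftrightarrow> independent_set G S \<and> card S = independence_number G"

definition hitting_set :: "'a pair_pre_digraph \<Rightarrow> 'a set \<Rightarrow> bool" where
  "hitting_set G T \<longleftrightarrow> T \<subseteq> pverts G \<and> (\<forall>S. maximum_independent_set G S \<longrightarrow> T \<inter> S \<noteq> {})"

text \<open>
  A finite graph with at least one vertex has a hitting set, namely its whole vertex set; the
  graph without vertices has none, and there the minimum below is taken over the empty set.
\<close>

definition hitting_number :: "'a pair_pre_digraph \<Rightarrow> nat" where
  "hitting_number G = Min (card ` {T. hitting_set G T})"

end

theory Submission
  imports Defs "HOL-Real_Asymp.Real_Asymp"
begin

text \<open>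
  Let $S$ be a maximum independent set and let $d(v)$ be the number of its vertices adjacent
  to $v$. At most $9$ pairwise disjoint disks of radius at least $r$ touch a disk of radius
  $r$; counting each edge between two independent sets at its smaller disk, at most
  $9|S|/(D-9)$ vertices of an independent set $T$ have $d \<ge> D$. Take $Y \<subseteq> S$ slightly larger
  than this and let $H$ be $Y$ together with its neighbours $v$ with $d(v) < D$. If a maximum
  independent set $T$ avoided $H$, every neighbour of $Y$ in $T$ would have $d \<ge> D$, so
  replacing these neighbours by $Y$ would enlarge $T$.

  On average over $Y$, $|H| \<le> |Y|\,(1 + E_D/|S|)$ where $E_D$ is the sum of $d(v)$ over
  $d(v) < D$. Since the sum of $E_D/D$ over powers $D$ of $2$ is at most $2n$,
  some $D = 2^i$ with $i$ between $\log n/20$ and $19 \log n/20$ has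
  $E_D/D \<le> (20/9 + o(1))\,n/\log n$, and then $|H| \<le> (20 + o(1))\,n/\log n$.
\<close>

section \<open>Disjoint disks touching a smaller disk\<close>

text \<open>A volume comparison: each ball contains a ball of radius exactly \<open>r\<close>
  through a point shared with \<open>cball p r\<close>. These smaller balls are disjoint and all lie
  in \<open>cball p (3 * r)\<close>.\<close>

lemma card_disjoint_cballs_touching_le:
  fixes x :: "'b \<Rightarrow> 'c::euclidean_space"
  assumes "finite T" "0 < r"
    and large: "\<And>t. t \<in> T \<Longrightarrow> r \<le> R t"
    and touch: "\<And>t. t \<in> T \<Longrightarrow> cball (x t) (R t) \<inter> cball p r \<noteq> {}"
    and disj: "disjoint_family_on (\<lambda>t. cball (x t) (R t)) T"
  shows "card T \<le> 3 ^ DIM('c)"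
proof -
  have "\<exists>z. cball z r \<subseteq> cball (x t) (R t) \<and> cball z r \<subseteq> cball p (3 * r)" if t: "t \<in> T" for t
  proof -
    obtain w where w: "dist (x t) w \<le> R t" "dist p w \<le> r"
      using touch[OF t] by auto
    have R: "0 < R t" "r \<le> R t"
      using large[OF t] \<open>0 < r\<close> by auto
    \<comment> \<open>The homothety with centre \<open>w\<close> and ratio
      \<open>r / R t <= 1\<close> maps the ball into itself, because \<open>w\<close> belongs to it;
      \<open>z\<close> is the image of its centre.\<close>
    define z where "z = w + (r / R t) *\<^sub>R (x t - w)"
    have "dist w z = r / R t * dist (x t) w"
      using R \<open>0 < r\<close> by (simp add: z_def dist_norm)
    also have "\<dots> \<le> r / R t * R t"
      using w R \<open>0 < r\<close> by (intro mult_left_mono) auto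
    finally have wz: "dist w z \<le> r"
      using R by simp
    have "x t - z = (1 - r / R t) *\<^sub>R (x t - w)"
      by (simp add: z_def algebra_simps)
    then have "dist (x t) z = (1 - r / R t) * dist (x t) w"
      using R by (simp add: dist_norm)
    also have "\<dots> \<le> (1 - r / R t) * R t"
      using w R by (intro mult_left_mono) auto
    finally have xz: "dist (x t) z \<le> R t - r"
      using R by (simp add: algebra_simps)
    have "cball z r \<subseteq> cball (x t) (R t)"
      using xz using dist_triangle[of "x t" _ z] by (force simp: subset_iff intro: order_trans)
    moreover have "cball z r \<subseteq> cball p (3 * r)"
    proof
      fix u assume "u \<in> cball z r"
      then have "dist z u \<le> r" by simp
      moreover have "dist p u \<le> dist p w + dist w z + dist z u"
        using dist_triangle[of p u w] dist_triangle[of w u z] by linarith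
      ultimately show "u \<in> cball p (3 * r)"
        using w wz by simp
    qed
    ultimately show ?thesis by blast
  qed
  then obtain z where z: "\<And>t. t \<in> T \<Longrightarrow> cball (z t) r \<subseteq> cball (x t) (R t)"
      "\<And>t. t \<in> T \<Longrightarrow> cball (z t) r \<subseteq> cball p (3 * r)"
    by metis
  have "disjoint_family_on (\<lambda>t. cball (z t) r) T"
    using disj z(1) unfolding disjoint_family_on_def by blast
  then have "measure lborel (\<Union>t\<in>T. cball (z t) r) = (\<Sum>t\<in>T. measure lborel (cball (z t) r))"
    using \<open>finite T\<close> by (intro measure_finite_Union) (auto simp: less_top emeasure_lborel_cball_finite[unfolded infinity_ennreal_def])
  also have "\<dots> = card T * (unit_ball_vol DIM('c) * r ^ DIM('c))"
    using \<open>0 < r\<close> by (simp add: content_cball)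
  finally have "card T * (unit_ball_vol DIM('c) * r ^ DIM('c)) = measure lborel (\<Union>t\<in>T. cball (z t) r)"
    by simp
  also have "\<dots> \<le> measure lborel (cball p (3 * r))"
    using \<open>finite T\<close> z(2) emeasure_lborel_cball_finite[of p "3 * r"]
    by (intro measure_mono_fmeasurable) (auto simp: fmeasurable_def intro!: sets.finite_UN)
  also have "\<dots> = 3 ^ DIM('c) * (unit_ball_vol DIM('c) * r ^ DIM('c))"
    using \<open>0 < r\<close> by (simp add: content_cball power_mult_distrib)
  finally have "real (card T) \<le> 3 ^ DIM('c)"
    using \<open>0 < r\<close> by (subst (asm) mult_le_cancel_right_pos) simp_all
  then show ?thesis
    using of_nat_le_iff[where 'a = real, of "card T" "3 ^ DIM('c)"] by simp
qed

text \<open>Count meeting pairs \<open>(t, s)\<close> with \<open>R s <= R t\<close>. By packing,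
  each \<open>t\<close> loses at most 9 of its \<open>D\<close> partners when the larger disks are
  dropped, and each \<open>s\<close> lies in at most 9 pairs. For \<open>D <= 9\<close> the
  truncated difference makes the claim trivial.\<close>

lemma card_high_degree_disks_le:
  fixes x :: "'b \<Rightarrow> real ^ 2"
  assumes fin: "finite S" "finite T"
    and pos: "\<And>v. v \<in> S \<union> T \<Longrightarrow> 0 < R v"
    and disjS: "disjoint_family_on (\<lambda>v. cball (x v) (R v)) S"
    and disjT: "disjoint_family_on (\<lambda>v. cball (x v) (R v)) T"
    and deg: "\<And>t. t \<in> T \<Longrightarrow> D \<le> card {s \<in> S. cball (x t) (R t) \<inter> cball (x s) (R s) \<noteq> {}}"
  shows "(D - 9) * card T \<le> 9 * card S"
proof -
  let ?meet = "\<lambda>t s. cball (x t) (R t) \<inter> cball (x s) (R s) \<noteq> {}"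
  have few: "card {u \<in> U. ?meet u v \<and> R v \<le> R u} \<le> 9"
    if "finite U" "disjoint_family_on (\<lambda>v. cball (x v) (R v)) U" "0 < R v" for U v
  proof -
    have "card {u \<in> U. ?meet u v \<and> R v \<le> R u} \<le> 3 ^ DIM(real ^ 2)"
    proof (rule card_disjoint_cballs_touching_le[of _ "R v" R x "x v"])
      show "disjoint_family_on (\<lambda>u. cball (x u) (R u)) {u \<in> U. ?meet u v \<and> R v \<le> R u}"
        by (rule disjoint_family_on_mono[OF _ that(2)]) blast
    qed (use that in simp_all)
    then show ?thesis by simp
  qed
  have "D - 9 \<le> card {s \<in> S. ?meet t s \<and> R s \<le> R t}" if t: "t \<in> T" for t
  proof -
    \<comment> \<open>Disks of equal radius fall into both sets, which is harmless for an upper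
      bound.\<close>
    have "card {s \<in> S. ?meet t s} \<le>
        card ({s \<in> S. ?meet t s \<and> R s \<le> R t} \<union> {s \<in> S. ?meet s t \<and> R t \<le> R s})"
      using fin by (intro card_mono) auto
    also have "\<dots> \<le> card {s \<in> S. ?meet t s \<and> R s \<le> R t} + card {s \<in> S. ?meet s t \<and> R t \<le> R s}"
      by (rule card_Un_le)
    finally show ?thesis
      using deg[OF t] few[OF fin(1) disjS pos[OF UnI2[OF t]]] by linarith
  qed
  then have "(\<Sum>t\<in>T. D - 9) \<le> (\<Sum>t\<in>T. card {s \<in> S. ?meet t s \<and> R s \<le> R t})"
    by (intro sum_mono)
  also have "\<dots> = (\<Sum>s\<in>S. card {t \<in> T. ?meet t s \<and> R s \<le> R t})"
    using sum.swap_restrict[OF fin(2) fin(1), of "\<lambda>_ _. 1::nat" "\<lambda>t s. ?meet t s \<and> R s \<le> R t"] by simp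
  also have "\<dots> \<le> (\<Sum>s\<in>S. 9)"
    by (intro sum_mono few[OF fin(2) disjT] pos) simp
  finally show ?thesis
    by (simp add: mult.commute)
qed

section \<open>Independence and hitting numbers of finite graphs\<close>

lemma finite_independent_sets: "finite (pverts G) \<Longrightarrow> finite {S. independent_set G S}"
  by (rule finite_subset[of _ "Pow (pverts G)"]) (auto simp: independent_set_def)

lemma card_independent_set_le:
  "finite (pverts G) \<Longrightarrow> independent_set G S \<Longrightarrow> card S \<le> independence_number G"
  unfolding independence_number_def by (intro Max_ge) (auto simp: finite_independent_sets)

lemma exists_maximum_independent_set:
  assumes "finite (pverts G)"
  obtains S where "maximum_independent_set G S"
proof -
  have "independent_set G {}"
    by (simp add: independent_set_def)
  then have "independence_number G \<in> card ` {S. independent_set G S}"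
    unfolding independence_number_def using assms finite_independent_sets
    by (intro Max_in) auto
  then show ?thesis
    using that by (auto simp: maximum_independent_set_def)
qed

lemma hitting_number_le:
  assumes "finite (pverts G)" "hitting_set G H"
  shows "hitting_number G \<le> card H"
proof -
  have "finite {T. hitting_set G T}"
    using assms(1) by (auto intro!: finite_subset[of "{T. hitting_set G T}" "Pow (pverts G)"] simp: hitting_set_def)
  then show ?thesis
    unfolding hitting_number_def using assms(2) by (intro Min_le) auto
qed

section \<open>Low-degree neighbourhoods as hitting sets\<close>

text \<open>Vertices of an independent set \<open>S\<close> have value 0 here, so they add nothing
  to the degree sums below.\<close>

abbreviation degree_in :: "'a pair_pre_digraph \<Rightarrow> 'a set \<Rightarrow> 'a \<Rightarrow> nat" where
  "degree_in G S v \<equiv> card {s \<in> S. (v, s) \<in> parcs G}"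

lemma disk_graph_low_degree_neighbourhood_hits:
  assumes G: "disk_graph G" and S: "maximum_independent_set G S" and Y: "Y \<subseteq> S"
    and big: "9 * card S < (D - 9) * card Y"
  shows "hitting_set G (Y \<union> {v \<in> pverts G. degree_in G S v < D \<and> (\<exists>y\<in>Y. (v, y) \<in> parcs G)})"
    (is "hitting_set G ?H")
  unfolding hitting_set_def
proof (intro conjI allI impI notI)
  show "?H \<subseteq> pverts G"
    using S Y by (auto simp: maximum_independent_set_def independent_set_def)
next
  fix T assume T: "maximum_independent_set G T" and empty: "?H \<inter> T = {}"
  obtain F where disks: "\<And>v. v \<in> pverts G \<Longrightarrow> is_disk (F v)"
      and GF: "G = intersection_graph (pverts G) F" and fin: "finite (pverts G)"
    using G unfolding disk_graph_def by auto
  have arc: "(u, v) \<in> parcs G \<longleftrightarrow> u \<in> pverts G \<and> v \<in> pverts G \<and> u \<noteq> v \<and> F u \<inter> F v \<noteq> {}" for u v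
    by (subst GF) (simp add: intersection_graph_def)
  obtain x R where xR: "\<And>v. v \<in> pverts G \<Longrightarrow> 0 < R v \<and> F v = cball (x v) (R v)"
  proof -
    have "\<forall>v. \<exists>x r. v \<in> pverts G \<longrightarrow> 0 < r \<and> F v = cball x r"
      using disks unfolding is_disk_def by blast
    then show ?thesis
      using that by metis
  qed
  have ST: "S \<subseteq> pverts G" "T \<subseteq> pverts G"
      "\<And>u v. u \<in> S \<Longrightarrow> v \<in> S \<Longrightarrow> (u, v) \<notin> parcs G"
      "\<And>u v. u \<in> T \<Longrightarrow> v \<in> T \<Longrightarrow> (u, v) \<notin> parcs G"
      "card T = independence_number G"
    using S T by (auto simp: maximum_independent_set_def independent_set_def)
  then have finST: "finite S" "finite T"
    by (auto intro: finite_subset[OF _ fin])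
  have disj: "disjoint_family_on (\<lambda>v. cball (x v) (R v)) U"
    if "U \<subseteq> pverts G" "\<And>u v. u \<in> U \<Longrightarrow> v \<in> U \<Longrightarrow> (u, v) \<notin> parcs G" for U
    unfolding disjoint_family_on_def
  proof (intro ballI impI)
    fix u v assume "u \<in> U" "v \<in> U" "u \<noteq> v"
    moreover from this have "u \<in> pverts G" "v \<in> pverts G"
      using that(1) by auto
    ultimately show "cball (x u) (R u) \<inter> cball (x v) (R v) = {}"
      using that(2)[of u v] arc[of u v] xR[of u] xR[of v] by simp
  qed
  \<comment> \<open>Exchange argument: \<open>B\<close> is what must leave \<open>T\<close> for
    \<open>Y\<close> to enter. Maximality of \<open>T\<close> then forces
    \<open>card Y <= card B\<close>.\<close>
  define B where "B = {t \<in> T. \<exists>y\<in>Y. (t, y) \<in> parcs G}"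
  have B: "B \<subseteq> T" "finite B"
    using finST by (auto simp: B_def)
  have "independent_set G ((T - B) \<union> Y)"
    unfolding independent_set_def
  proof (intro conjI ballI)
    show "(T - B) \<union> Y \<subseteq> pverts G"
      using ST Y by blast
  next
    have sym: "(u, v) \<in> parcs G \<Longrightarrow> (v, u) \<in> parcs G" for u v
      using arc by blast
    fix u v assume "u \<in> (T - B) \<union> Y" "v \<in> (T - B) \<union> Y"
    then consider "u \<in> T" "v \<in> T" | "u \<in> S" "v \<in> S" | "u \<in> T - B" "v \<in> Y" | "v \<in> T - B" "u \<in> Y"
      using Y by blast
    then show "(u, v) \<notin> parcs G"
      by cases (use ST(3,4) sym in \<open>auto simp: B_def\<close>)
  qed
  then have "card ((T - B) \<union> Y) \<le> card T"
    using card_independent_set_le[OF fin] ST by simp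
  \<comment> \<open>\<open>Y\<close> is part of the set that \<open>T\<close> avoids, so the union
    is disjoint.\<close>
  moreover have "card ((T - B) \<union> Y) = card (T - B) + card Y"
    using empty finST finite_subset[OF Y finST(1)] by (intro card_Un_disjoint) auto
  moreover have "card T = card (T - B) + card B"
    using B finST by (metis card_Diff_subset card_mono le_add_diff_inverse2)
  ultimately have "card Y \<le> card B"
    by linarith
  \<comment> \<open>A vertex of \<open>B\<close> has a neighbour in \<open>Y\<close> but is not in
    the candidate hitting set, so it can only have failed the degree test.\<close>
  have "D \<le> card {s \<in> S. cball (x t) (R t) \<inter> cball (x s) (R s) \<noteq> {}}" if "t \<in> B" for t
  proof -
    have "t \<in> T" "t \<in> pverts G" "\<exists>y\<in>Y. (t, y) \<in> parcs G"
      using that B ST by (auto simp: B_def)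
    then have "\<not> degree_in G S t < D"
      using empty by blast
    then have "D \<le> degree_in G S t"
      by simp
    also have "\<dots> \<le> card {s \<in> S. cball (x t) (R t) \<inter> cball (x s) (R s) \<noteq> {}}"
    proof (rule card_mono)
      show "{s \<in> S. (t, s) \<in> parcs G} \<subseteq> {s \<in> S. cball (x t) (R t) \<inter> cball (x s) (R s) \<noteq> {}}"
        using arc xR by auto
    qed (use finST in simp)
    finally show ?thesis .
  qed
  then have "(D - 9) * card B \<le> 9 * card S"
  proof (intro card_high_degree_disks_le[where x = x and R = R])
    show "disjoint_family_on (\<lambda>v. cball (x v) (R v)) S"
      by (rule disj) (use ST in simp_all)
    show "disjoint_family_on (\<lambda>v. cball (x v) (R v)) B"
      by (rule disj) (use ST(2,4) B(1) in blast)+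
    show "0 < R v" if "v \<in> S \<union> B" for v
      using that ST B xR[of v] by blast
  qed (use finST B in simp_all)
  moreover have "(D - 9) * card Y \<le> (D - 9) * card B"
    using \<open>card Y \<le> card B\<close> by simp
  ultimately show False
    using big by linarith
qed

section \<open>Averaging over subsets and over dyadic thresholds\<close>

text \<open>Starting from \<open>S\<close>, delete an element of largest weight again and again: the
  average of \<open>f\<close> over what remains never increases. The induction runs downwards from
  \<open>card S\<close> to \<open>q\<close>.\<close>

lemma exists_subset_sum_le_average:
  fixes f :: "'b \<Rightarrow> real"
  assumes "finite S" "q \<le> card S"
  shows "\<exists>Y\<subseteq>S. card Y = q \<and> card S * sum f Y \<le> q * sum f S"
  using assms(2)
proof (induction rule: inc_induct)
  case base
  show ?case by blast
next
  case (step q)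
  then obtain Y where Y: "Y \<subseteq> S" "card Y = Suc q" "card S * sum f Y \<le> Suc q * sum f S"
    by blast
  then have finY: "finite Y" "Y \<noteq> {}"
    using assms(1) by (auto intro: finite_subset)
  obtain y where y: "y \<in> Y" "\<And>u. u \<in> Y \<Longrightarrow> f u \<le> f y"
  proof -
    have "Max (f ` Y) \<in> f ` Y"
      using finY by simp
    then obtain y where "y \<in> Y" "f y = Max (f ` Y)"
      by force
    then show ?thesis
      using finY by (intro that[of y]) auto
  qed
  have diff: "sum f (Y - {y}) = sum f Y - f y"
    using y finY by (simp add: sum_diff1)
  have "sum f Y \<le> Suc q * f y"
    using sum_bounded_above[of Y f "f y"] y Y by simp
  then have "Suc q * (sum f Y - f y) \<le> q * sum f Y"
    by (simp add: algebra_simps)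
  then have "card S * (Suc q * (sum f Y - f y)) \<le> card S * (q * sum f Y)"
    by (intro mult_left_mono) auto
  also have "\<dots> = q * (card S * sum f Y)"
    by simp
  also have "\<dots> \<le> q * (Suc q * sum f S)"
    using Y by (intro mult_left_mono) auto
  finally have "Suc q * (card S * (sum f Y - f y)) \<le> Suc q * (q * sum f S)"
    by (simp only: mult.left_commute)
  then have "card S * sum f (Y - {y}) \<le> q * sum f S"
    unfolding diff by (simp only: mult_le_cancel_left_pos of_nat_0_less_iff zero_less_Suc)
  moreover have "card (Y - {y}) = q"
    using y Y by simp
  ultimately show ?case
    using Y by blast
qed

text \<open>The terms form part of a geometric series of ratio 1/2 that starts at the first
  \<open>j\<close> with \<open>d < 2 ^ j\<close>, where the term is at most 1.\<close>

lemma sum_div_power2_le: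
  fixes d :: nat
  shows "(\<Sum>i \<in> {i \<in> {m..<k}. d < 2 ^ i}. real d / 2 ^ i) \<le> 2"
proof -
  define j where "j = (LEAST i. d < 2 ^ i)"
  have "d < 2 ^ j"
    unfolding j_def by (rule LeastI[of _ d]) (rule less_exp)
  have "(\<Sum>i \<in> {i \<in> {m..<k}. d < 2 ^ i}. real d / 2 ^ i) \<le> (\<Sum>i = j..<j + k. real d / 2 ^ i)"
    by (intro sum_mono2) (auto simp: j_def Least_le trans_less_add2)
  also have "\<dots> = real d / 2 ^ j * (2 - 2 / 2 ^ k)"
    by (induction k) (auto simp: field_simps power_add)
  also have "\<dots> \<le> 1 * 2"
  proof (intro mult_mono)
    show "real d / 2 ^ j \<le> 1"
      using \<open>d < 2 ^ j\<close> by (simp add: less_imp_le)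
    show "0 \<le> 2 - 2 / (2 :: real) ^ k"
      by (simp add: divide_le_eq)
  qed auto
  finally show ?thesis by simp
qed

lemma divide_diff_antimono:
  fixes a u v :: "'b::linordered_field"
  assumes "0 \<le> a" "a < u" "u \<le> v"
  shows "v / (v - a) \<le> u / (u - a)"
proof -
  have "w / (w - a) = 1 + a / (w - a)" if "a < w" for w
    using that by (simp add: field_simps)
  moreover have "a / (v - a) \<le> a / (u - a)"
    using assms by (intro divide_left_mono) auto
  ultimately show ?thesis
    using assms by simp
qed

section \<open>The bound for a fixed range of dyadic thresholds\<close>

lemma disk_graph_hitting_number_le:
  assumes G: "disk_graph G" and "m < k" "27 \<le> (2::real) ^ m" "2 \<le> independence_number G"
  defines "n \<equiv> real (card (pverts G))" and "a \<equiv> real (independence_number G)"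
    and "L \<equiv> real k - real m"
  shows "hitting_number G \<le> 1 + 9 * a / (2 ^ m - 9) + 18 * n / L * (2 ^ m / (2 ^ m - 9)) + n * 2 ^ k / (L * a)"
proof -
  have fin: "finite (pverts G)"
    using G by (simp add: disk_graph_def)
  obtain S where S: "maximum_independent_set G S"
    using exists_maximum_independent_set[OF fin] .
  then have cardS: "card S = independence_number G" and subS: "S \<subseteq> pverts G"
    by (auto simp: maximum_independent_set_def independent_set_def)
  have finS: "finite S"
    using fin subS by (rule finite_subset[rotated])
  have a: "a = card S" "2 \<le> a" and L: "0 < L"
    using assms cardS by auto
  define E where "E D = (\<Sum>v \<in> {v \<in> pverts G. degree_in G S v < D}. real (degree_in G S v))" for D
  \<comment> \<open>Pigeonhole over the \<open>L\<close> exponents: the quotients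
    \<open>E (2 ^ i) / 2 ^ i\<close> add up to at most \<open>2 * n\<close>, since each vertex
    contributes at most 2 by the dyadic sum.\<close>
  have "\<exists>i \<in> {m..<k}. E (2 ^ i) / 2 ^ i \<le> 2 * n / L"
  proof (rule ccontr)
    assume "\<not> ?thesis"
    then have "(\<Sum>i = m..<k. 2 * n / L) < (\<Sum>i = m..<k. E (2 ^ i) / 2 ^ i)"
      using \<open>m < k\<close> by (intro sum_strict_mono) (auto simp: not_le)
    also have "\<dots> = (\<Sum>i = m..<k. \<Sum>v \<in> {v \<in> pverts G. degree_in G S v < 2 ^ i}. real (degree_in G S v) / 2 ^ i)"
      by (simp add: E_def sum_divide_distrib)
    also have "\<dots> = (\<Sum>v \<in> pverts G. \<Sum>i \<in> {i \<in> {m..<k}. degree_in G S v < 2 ^ i}. real (degree_in G S v) / 2 ^ i)"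
      using fin by (intro sum.swap_restrict) auto
    also have "\<dots> \<le> (\<Sum>v \<in> pverts G. 2)"
      by (intro sum_mono sum_div_power2_le)
    also have "\<dots> = 2 * n"
      by (simp add: n_def)
    finally show False
      using \<open>m < k\<close> by (simp add: L_def of_nat_diff)
  qed
  then obtain i where i: "m \<le> i" "i < k" "E (2 ^ i) / 2 ^ i \<le> 2 * n / L"
    by auto
  define D :: nat where "D = 2 ^ i"
  have D: "2 ^ m \<le> real D" "2 * real D \<le> 2 ^ k"
    using i power_increasing[of m i "2::real"] power_increasing[of "Suc i" k "2::real"]
    by (auto simp: D_def)
  then have D27: "27 \<le> D"
    using assms(3) by linarith
  have ED: "E D \<le> 2 * n / L * D"
    using i(3) by (simp add: D_def pos_divide_le_eq)
  \<comment> \<open>The least size of \<open>Y\<close> that makes its low-degree neighbourhood,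
    together with \<open>Y\<close>, a hitting set.\<close>
  define q where "q = 9 * card S div (D - 9) + 1"
  have q_gt: "9 * card S < (D - 9) * q"
    using dividend_less_times_div[of "D - 9" "9 * card S"] D27 by (simp add: q_def)
  have q_le: "real q \<le> 9 * a / (real D - 9) + 1"
    using of_nat_div_le_of_nat[where 'a = real, of "9 * card S" "D - 9"] D27 by (simp add: q_def a of_nat_diff)
  \<comment> \<open>From \<open>27 <= D\<close> one gets \<open>q <= a / 2 + 1\<close>, which is at
    most \<open>a\<close> because \<open>2 <= a\<close>; so \<open>S\<close> has a subset of size
    \<open>q\<close>.\<close>
  also have "9 * a / (real D - 9) \<le> 9 * a / 18"
    using D27 a by (intro divide_left_mono) auto
  finally have "q \<le> card S"
    using a by simp
  define w where "w y = card {v \<in> pverts G. degree_in G S v < D \<and> (v, y) \<in> parcs G}" for y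
  \<comment> \<open>Double counting of the arcs from low-degree vertices into
    \<open>S\<close>.\<close>
  have sum_w: "(\<Sum>y\<in>S. real (w y)) = E D"
    using sum.swap_restrict[OF finS, of "{v \<in> pverts G. degree_in G S v < D}" "\<lambda>_ _. 1::real" "\<lambda>y v. (v, y) \<in> parcs G"] fin
    by (simp add: w_def E_def conj_assoc)
  obtain Y where Y: "Y \<subseteq> S" "card Y = q" "a * (\<Sum>y\<in>Y. real (w y)) \<le> q * E D"
    using exists_subset_sum_le_average[OF finS \<open>q \<le> card S\<close>, of "\<lambda>y. real (w y)"] sum_w a by auto
  define H where "H = Y \<union> {v \<in> pverts G. degree_in G S v < D \<and> (\<exists>y\<in>Y. (v, y) \<in> parcs G)}"
  have "hitting_set G H"
    unfolding H_def using disk_graph_low_degree_neighbourhood_hits[OF G S Y(1)] q_gt Y by simp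
  then have "hitting_number G \<le> card H"
    by (rule hitting_number_le[OF fin])
  also have "H = Y \<union> (\<Union>y\<in>Y. {v \<in> pverts G. degree_in G S v < D \<and> (v, y) \<in> parcs G})"
    by (auto simp: H_def)
  also have "card \<dots> \<le> card Y + (\<Sum>y\<in>Y. w y)"
    unfolding w_def using finite_subset[OF Y(1) finS]
    by (intro order_trans[OF card_Un_le] add_left_mono card_UN_le)
  finally have "real (hitting_number G) \<le> q + (\<Sum>y\<in>Y. real (w y))"
    using Y by (metis of_nat_add of_nat_le_iff of_nat_sum)
  also have "\<dots> \<le> q + q * E D / a"
    using Y a by (simp add: pos_le_divide_eq mult.commute)
  also have "q + q * E D / a = q * (1 + E D / a)"
    by (simp add: algebra_simps)
  also have "\<dots> \<le> (9 * a / (real D - 9) + 1) * (1 + (2 * n / L * D) / a)"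
    using q_le ED a by (intro mult_mono add_left_mono divide_right_mono) (auto simp: E_def sum_nonneg)
  also have "\<dots> = 1 + 9 * a / (real D - 9) + 18 * n / L * (D / (real D - 9)) + n * (2 * D) / (L * a)"
  proof -
    have "(9 * a / e + 1) * (1 + (2 * n / L * d) / a)
        = 1 + 9 * a / e + 18 * n / L * (d / e) + n * (2 * d) / (L * a)" if "e \<noteq> 0" for d e
      using that a(2) L by (simp add: field_simps)
    then show ?thesis
      using D27 by simp
  qed
  \<comment> \<open>The terms decreasing in \<open>D\<close> are taken at \<open>2 ^ m\<close>; the
    increasing one uses \<open>2 * D <= 2 ^ k\<close>, which holds as \<open>i < k\<close>.\<close>
  also have "\<dots> \<le> 1 + 9 * a / (2 ^ m - 9) + 18 * n / L * (2 ^ m / (2 ^ m - 9)) + n * 2 ^ k / (L * a)"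
  proof (intro add_mono mult_left_mono divide_left_mono divide_right_mono order_refl)
    show "real D / (real D - 9) \<le> 2 ^ m / (2 ^ m - 9)"
      using D assms(3) by (intro divide_diff_antimono) auto
  qed (use D D27 assms(3) a L in \<open>auto simp: n_def\<close>)
  finally show ?thesis .
qed

section \<open>Asymptotics\<close>

text \<open>Only the third summand survives multiplication by \<open>t\<close>, with limit 18 /
  (9/10) = 20; the others decay exponentially. The gap between 20 and 25 absorbs all error
  terms.\<close>

lemma tendsto_hitting_bound:
  fixes c :: real
  assumes "c > 0"
  shows "((\<lambda>t::real. (1 / 2 powr t + 9 / (2 powr (t / 20) / 2 - 9)
    + 18 / (9 / 10 * t - 1) * ((2 powr (t / 20) / 2) / (2 powr (t / 20) / 2 - 9))
    + 2 powr (- t / 20) / (c * (9 / 10 * t - 1))) * t) \<longlongrightarrow> 20) at_top"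
  using assms by real_asymp

theorem theorem1p4:
  fixes c :: real
  assumes "c > 0"
  shows "\<exists>N. \<forall>n \<ge> N. \<forall>G :: 'a pair_pre_digraph.
           disk_graph G \<and> card (pverts G) = n \<and> real (independence_number G) = c * real n
             \<longrightarrow> real (hitting_number G) \<le> 25 * real n / log 2 (real n)"
proof -
  \<comment> \<open>With \<open>t = log 2 n\<close>, this is the preceding bound divided by
    \<open>n\<close>, after \<open>2 ^ m\<close>, \<open>L\<close> and \<open>2 ^ k\<close> are
    replaced by \<open>2 powr (t / 20) / 2\<close>, \<open>9 / 10 * t - 1\<close> and
    \<open>n * 2 powr (- t / 20)\<close>, and the independence number in the second summand by
    \<open>n\<close>.\<close>
  define g where "g t = 1 / 2 powr t + 9 / (2 powr (t / 20) / 2 - 9)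
    + 18 / (9 / 10 * t - 1) * ((2 powr (t / 20) / 2) / (2 powr (t / 20) / 2 - 9))
    + 2 powr (- t / 20) / (c * (9 / 10 * t - 1))" for t :: real
  have "filterlim (\<lambda>n. log 2 (real n)) at_top sequentially"
    by real_asymp
  moreover have "\<forall>\<^sub>F t in at_top. g t * t < 25"
    unfolding g_def using order_tendstoD(2)[OF tendsto_hitting_bound[OF assms]] by simp
  ultimately have "\<forall>\<^sub>F n in sequentially. g (log 2 (real n)) * log 2 (real n) < 25"
    by (rule eventually_compose_filterlim[rotated])
  moreover have "\<forall>\<^sub>F n in sequentially. 2 \<le> c * real n"
    using assms by real_asymp
  \<comment> \<open>As 120 / 20 - 1 = 5, this yields \<open>2 ^ m >= 32\<close>, enough for the
    required 27, and also \<open>m < k\<close>.\<close>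
  moreover have "\<forall>\<^sub>F n in sequentially. 120 \<le> log 2 (real n)"
    by real_asymp
  ultimately have "\<forall>\<^sub>F n in sequentially. g (log 2 (real n)) * log 2 (real n) < 25 \<and>
      2 \<le> c * real n \<and> 120 \<le> log 2 (real n)"
    by eventually_elim simp
  then obtain N where N: "\<And>n. n \<ge> N \<Longrightarrow> g (log 2 (real n)) * log 2 (real n) < 25 \<and>
      2 \<le> c * real n \<and> 120 \<le> log 2 (real n)"
    unfolding eventually_sequentially by blast
  have "real (hitting_number G) \<le> 25 * real n / log 2 (real n)"
    if "n \<ge> N" and G: "disk_graph G" and n: "card (pverts G) = n"
      and \<alpha>: "real (independence_number G) = c * real n" for n and G :: "'a pair_pre_digraph"
  proof -
    define t where "t = log 2 (real n)"
    have t: "g t * t < 25" "2 \<le> c * real n" "120 \<le> t"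
      using N[OF \<open>n \<ge> N\<close>] by (auto simp: t_def)
    have "0 < real n"
      using t(2) assms by (cases "n = 0") auto
    then have n_powr: "real n = 2 powr t"
      by (simp add: t_def)
    \<comment> \<open>The range has length about \<open>9 / 10 * t\<close>. Its lower end still
      grows, so \<open>2 ^ m / (2 ^ m - 9)\<close> tends to 1; its upper end keeps
      \<open>2 ^ k\<close> below the power 19/20 of \<open>n\<close>, so the last summand is
      negligible.\<close>
    define m where "m = nat \<lfloor>t / 20\<rfloor>"
    define k where "k = nat \<lfloor>19 / 20 * t\<rfloor>"
    define L where "L = real k - real m"
    \<comment> \<open>A lower bound for \<open>2 ^ m\<close>; the factor 1/2 pays for the
      floor.\<close>
    define p where "p = 2 powr (t / 20) / 2"
    have m: "real m \<le> t / 20" "t / 20 - 1 \<le> real m"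
      using t unfolding m_def by linarith+
    have k: "real k \<le> 19 / 20 * t" "19 / 20 * t - 1 \<le> real k"
      using t unfolding k_def by linarith+
    have L: "9 / 10 * t - 1 \<le> L" "0 < 9 / 10 * t - 1"
      using m k t by (auto simp: L_def)
    have "p = 2 powr (t / 20 - 1)"
      by (simp add: p_def powr_diff)
    also have "\<dots> \<le> 2 powr real m"
      using m by (intro powr_mono) auto
    finally have p_le: "p \<le> 2 ^ m"
      by (simp add: powr_realpow)
    have "2 powr 5 \<le> 2 powr (t / 20 - 1)"
      using t by (intro powr_mono) auto
    then have p_ge: "32 \<le> p"
      by (simp add: p_def powr_diff)
    have "2 powr real k \<le> 2 powr (t + - t / 20)"
      using k by (intro powr_mono) auto
    then have k_le: "2 ^ k \<le> real n * 2 powr (- t / 20)"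
      by (simp only: powr_add powr_realpow zero_less_numeral n_powr)
    have "m < k"
      using L t by (simp add: L_def)
    have "real (hitting_number G) \<le> 1 + 9 * (c * n) / (2 ^ m - 9)
        + 18 * real n / L * (2 ^ m / (2 ^ m - 9)) + real n * 2 ^ k / (L * (c * n))"
      using disk_graph_hitting_number_le[OF G \<open>m < k\<close>] p_le p_ge \<alpha> t n by (simp add: L_def)
    also have "\<dots> \<le> 1 + 9 * n / (p - 9) + 18 * n / (9 / 10 * t - 1) * (p / (p - 9))
        + n * (n * 2 powr (- t / 20)) / ((9 / 10 * t - 1) * (c * n))"
    proof (intro add_mono order_refl)
      \<comment> \<open>The independence number is at most \<open>n\<close>, which removes
        \<open>c\<close> from the second summand.\<close>
      have "finite (pverts G)"
        using G by (simp add: disk_graph_def)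
      then obtain S where "S \<subseteq> pverts G" "card S = independence_number G"
        using exists_maximum_independent_set[of G]
        unfolding maximum_independent_set_def independent_set_def by metis
      then have "independence_number G \<le> n"
        using card_mono[OF \<open>finite (pverts G)\<close>] n by metis
      then have "c * n \<le> n"
        using \<alpha> by simp
      then show "9 * (c * n) / (2 ^ m - 9) \<le> 9 * n / (p - 9)"
        using p_le p_ge by (intro frac_le) auto
      have "2 ^ m / (2 ^ m - 9) \<le> p / (p - 9)"
        using p_le p_ge by (intro divide_diff_antimono) auto
      moreover have "18 * real n / L \<le> 18 * n / (9 / 10 * t - 1)"
        using L by (intro frac_le) auto
      ultimately show "18 * real n / L * (2 ^ m / (2 ^ m - 9)) \<le> 18 * n / (9 / 10 * t - 1) * (p / (p - 9))"
        using L p_le p_ge by (intro mult_mono) auto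
      show "real n * 2 ^ k / (L * (c * n)) \<le> n * (n * 2 powr (- t / 20)) / ((9 / 10 * t - 1) * (c * n))"
        using L k_le t assms \<open>0 < real n\<close> by (intro frac_le mult_left_mono mult_right_mono mult_pos_pos) auto
    qed
    also have "\<dots> = n * g t"
    proof -
      have "n * (n * u) / (v * (c * n)) = n * (u / (c * v))" for u v :: real
        using \<open>0 < real n\<close> by simp
      then show ?thesis
        using \<open>0 < real n\<close> by (simp add: g_def p_def[symmetric] n_powr[symmetric] distrib_left mult_ac)
    qed
    also have "\<dots> \<le> n * (25 / t)"
      using t by (intro mult_left_mono) (auto simp: pos_le_divide_eq)
    finally show ?thesis
      by (simp add: t_def mult.commute)
  qed
  then show ?thesis
    by blast
qed

end
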